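(* Let $p$ be an odd prime and let $g\in G$, $g\neq 1$, be represented by a matrix $\begin{bmatrix}a&b\\c&d\end{bmatrix}\in\mathrm{GL}_2(\mathbb{Z})$ with $N:=\max(|a|,|b|,|c|,|d|)\le (p/128)^{1/8}$. Then $g$ has at most $1024\,p\,N^8$ fixed points on $M(\mathbb{F}_p)$.
   Context: $M(\mathbb{F}_p)$ denotes the set of triples $(x,y,z)\in\mathbb{F}_p^3\setminus\{(0,0,0)\}$ satisfying $x^2+y^2+z^2=xyz$. The Markoff moves are the maps $m_1(x,y,z)=(yz-x,y,z)$, $m_2(x,y,z)=(x,xz-y,z)$, $m_3(x,y,z)=(x,y,xy-z)$ on $M(\mathbb{F}_p)$. Let $G=\mathbb{Z}/2*\mathbb{Z}/2*\mathbb{Z}/2$ be the free product with generators $m_1,m_2,m_3$; it acts on $M(\mathbb{F}_p)$ with $m_i$ acting by the $i$-th Markoff move. There is an injective homomorphism $G\to\mathrm{PGL}_2(\mathbb{Z})$ sending $m_1,m_2,m_3$ to the classes of $\begin{bmatrix}1&0\\2&-1\end{bmatrix}$, $\begin{bmatrix}-1&2\\0&1\end{bmatrix}$, $\begin{bmatrix}-1&0\\0&1\end{bmatrix}$ respectively. An element $g\in G$ is said to be represented by a matrix in $\mathrm{GL}_2(\mathbb{Z})$ if that matrix lies in the class that is the image of $g$ (the matrix is determined up to sign). *)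

theory Defs
  imports Complex_Main "HOL-Computational_Algebra.Primes"
begin

definition markoff_pts :: "int \<Rightarrow> (int \<times> int \<times> int) set" where
  "markoff_pts p = {(x,y,z). x \<in> {0..<p} \<and> y \<in> {0..<p} \<and> z \<in> {0..<p}
       \<and> (x,y,z) \<noteq> (0,0,0) \<and> (x^2 + y^2 + z^2 - x*y*z) mod p = 0}"

fun markoff_move :: "int \<Rightarrow> nat \<Rightarrow> int \<times> int \<times> int \<Rightarrow> int \<times> int \<times> int" where
  "markoff_move p i (x,y,z) =
     (if i = 1 then ((y*z - x) mod p, y, z)
      else if i = 2 then (x, (x*z - y) mod p, z)
      else (x, y, (x*y - z) mod p))"

text \<open>Elements of G = Z/2 * Z/2 * Z/2 are in bijection with reduced words in the letters
  1,2,3 (no two adjacent letters equal); the empty word is the identity.\<close>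
definition reduced_word :: "nat list \<Rightarrow> bool" where
  "reduced_word w \<longleftrightarrow> set w \<subseteq> {1,2,3} \<and> (\<forall>i. Suc i < length w \<longrightarrow> w ! i \<noteq> w ! Suc i)"

definition word_act :: "int \<Rightarrow> nat list \<Rightarrow> int \<times> int \<times> int \<Rightarrow> int \<times> int \<times> int" where
  "word_act p w P = foldr (markoff_move p) w P"
  
type_synonym mat2 = "int \<times> int \<times> int \<times> int"

fun mat2_mult :: "mat2 \<Rightarrow> mat2 \<Rightarrow> mat2" where
  "mat2_mult (a,b,c,d) (e,f,g,h) = (a*e + b*g, a*f + b*h, c*e + d*g, c*f + d*h)"

definition gen_mat :: "nat \<Rightarrow> mat2" where
  "gen_mat i = (if i = 1 then (1,0,2,-1) else if i = 2 then (-1,2,0,1) else (-1,0,0,1))"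

definition word_mat :: "nat list \<Rightarrow> mat2" where
  "word_mat w = foldr (\<lambda>i M. mat2_mult (gen_mat i) M) w (1,0,0,1)"

text \<open>g is represented by [a b; c d] iff its image in PGL_2(Z) is the class of that matrix,
  i.e. the product of generator matrices equals it up to sign.\<close>
definition represented_by :: "nat list \<Rightarrow> mat2 \<Rightarrow> bool" where
  "represented_by w M \<longleftrightarrow> (case M of (a,b,c,d) \<Rightarrow>
      word_mat w = (a,b,c,d) \<or> word_mat w = (-a,-b,-c,-d))"

end

(* Let t be the coordinate created by the first move applied and u, v the two others, so that
   u^2 + v^2 + t^2 = u v t. On a slice v = l u, the substitution t = s u gives
   u = (s^2 + 1 + l^2) / (l s), so the slice is a rational curve on which u, v, t are Laurent
   polynomials in s of degrees 1, 1, 2. As the word is reduced, every further move replaces a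
   coordinate by one whose degree is the sum of the degrees of the other two, with invertible
   leading coefficient. The degrees therefore grow like the entries of the matrix, and equating
   the last moved coordinate with its original value, which has smaller degree, leaves O(N)
   values of s on each of the p - 1 slices. The points with u v t = 0 contribute at most 6 p. *)

theory Submission
  imports Defs "HOL-Computational_Algebra.Polynomial" "HOL-Number_Theory.Cong"
begin

section \<open>Counting roots modulo a prime\<close>

text \<open>Lagrange's bound, by dividing off one root at a time. If f = (X - r) g + f(r) with p
  dividing f(r), then g cannot have all coefficients divisible by p, since otherwise f would too. A
  root of f modulo p that is not a root of g is congruent to r, because p is prime, so each division
  costs one residue class.\<close>

lemma card_poly_roots_mod_prime:
  fixes p :: int and f :: "int poly"
  assumes "prime p" and "degree f \<le> n" and "\<not> p dvd coeff f i"
  shows "card {s \<in> {0..<p}. p dvd poly f s} \<le> n"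
  using assms(2,3)
proof (induction n arbitrary: f i)
  case 0
  then obtain c where f: "f = [:c:]" by (metis degree_eq_zeroE le_zero_eq)
  with 0 have "\<not> p dvd c" by (cases i) auto
  then show ?case using f by simp
next
  case (Suc n)
  show ?case
  proof (cases "\<exists>r. p dvd poly f r")
    case False
    then have "{s \<in> {0..<p}. p dvd poly f s} = {}" by blast
    then show ?thesis by (metis card.empty zero_le)
  next
    case True
    then obtain r where r: "p dvd poly f r" ..
    define g where "g = synthetic_div f r"
    have f: "f = [:-r, 1:] * g + [:poly f r:]"
      using synthetic_div_correct'[of r f] by (simp add: g_def)
    have "\<exists>k. \<not> p dvd coeff g k"
    proof (rule ccontr)
      assume "\<nexists>k. \<not> p dvd coeff g k"
      then have g: "p dvd coeff g k" for k by blast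
      have "coeff f i = coeff ([:-r, 1:] * g + [:poly f r:]) i" using f by simp
      also have "p dvd \<dots>" using g r by (cases i) (auto simp: coeff_pCons)
      finally show False using Suc.prems by simp
    qed
    then obtain k where "\<not> p dvd coeff g k" ..
    moreover have "degree g \<le> n" using Suc.prems by (simp add: g_def degree_synthetic_div)
    ultimately have IH: "card {s \<in> {0..<p}. p dvd poly g s} \<le> n" by (rule Suc.IH[rotated])
    have "s = r mod p" if "s \<in> {0..<p}" "p dvd poly f s" "\<not> p dvd poly g s" for s
    proof -
      have "poly f s = (s - r) * poly g s + poly f r"
        by (subst f) (simp add: algebra_simps)
      then have "p dvd (s - r) * poly g s" using that(2) r by (metis dvd_add_left_iff)
      then have "p dvd s - r" using that(3) \<open>prime p\<close> by (simp add: prime_dvd_mult_iff)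
      then show ?thesis using that(1) by (metis atLeastLessThan_iff mod_eq_dvd_iff mod_pos_pos_trivial)
    qed
    then have "{s \<in> {0..<p}. p dvd poly f s} \<subseteq> insert (r mod p) {s \<in> {0..<p}. p dvd poly g s}"
      by blast
    then have "card {s \<in> {0..<p}. p dvd poly f s} \<le> card (insert (r mod p) {s \<in> {0..<p}. p dvd poly g s})"
      by (rule card_mono[rotated]) (auto intro: rev_finite_subset[of "{0..<p}"])
    also have "\<dots> \<le> Suc n" using IH by (intro card_insert_le_m1) auto
    finally show ?thesis .
  qed
qed

text \<open>For fixed \<open>a\<close> the admissible \<open>b\<close> are roots of the monic
  quadratic X^2 + a^2, so there are at most two. The degenerate points set aside before slicing are
  injected into this set.\<close>

lemma card_sum_two_squares_mod_prime:
  fixes p :: int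
  assumes "prime p"
  shows "card {(a, b). a \<in> {0..<p} \<and> b \<in> {0..<p} \<and> p dvd a\<^sup>2 + b\<^sup>2} \<le> 2 * nat p"
proof -
  have p1: "p > 1" using assms by (simp add: prime_gt_1_int)
  have b: "card {b \<in> {0..<p}. p dvd a\<^sup>2 + b\<^sup>2} \<le> 2" for a
    using card_poly_roots_mod_prime[OF assms, of "[:a\<^sup>2, 0, 1:]" 2 2] p1
    by (simp add: power2_eq_square coeff_pCons numeral_2_eq_2)
  have "{(a, b). a \<in> {0..<p} \<and> b \<in> {0..<p} \<and> p dvd a\<^sup>2 + b\<^sup>2}
      = Sigma {0..<p} (\<lambda>a. {b \<in> {0..<p}. p dvd a\<^sup>2 + b\<^sup>2})" by auto
  also have "card \<dots> = (\<Sum>a\<in>{0..<p}. card {b \<in> {0..<p}. p dvd a\<^sup>2 + b\<^sup>2})"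
    by (rule card_SigmaI) (auto intro: finite_subset[of _ "{0..<p}"])
  also have "\<dots> \<le> (\<Sum>a\<in>{0..<p}. 2)" using b by (intro sum_mono)
  finally show ?thesis using p1 by simp
qed

section \<open>Laurent degrees along a slice\<close>

text \<open>On \<^term>\<open>T\<close>, with parameter \<^term>\<open>\<sigma>\<close>, the function \<^term>\<open>f\<close> is modulo \<^term>\<open>p\<close> a
  Laurent polynomial in \<^term>\<open>\<sigma>\<close> with pole of order exactly \<^term>\<open>w\<close> at infinity and at most
  \<^term>\<open>w\<close> at zero.\<close>

definition laurent :: "int \<Rightarrow> 'a set \<Rightarrow> ('a \<Rightarrow> int) \<Rightarrow> nat \<Rightarrow> ('a \<Rightarrow> int) \<Rightarrow> bool" where
  "laurent p T \<sigma> w f \<longleftrightarrow> (\<exists>F. degree F \<le> 2 * w \<and> \<not> p dvd coeff F (2 * w) \<and>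
     (\<forall>P\<in>T. [\<sigma> P ^ w * f P = poly F (\<sigma> P)] (mod p)))"

text \<open>The bound 3 accommodates the three original coordinates: cleared of the denominator
  $\<sigma>^2$, they stay below the degree 4 reached by any moved coordinate.\<close>

definition laurent_low :: "int \<Rightarrow> 'a set \<Rightarrow> ('a \<Rightarrow> int) \<Rightarrow> ('a \<Rightarrow> int) \<Rightarrow> bool" where
  "laurent_low p T \<sigma> f \<longleftrightarrow> (\<exists>F. degree F \<le> 3 \<and> (\<forall>P\<in>T. [\<sigma> P ^ 2 * f P = poly F (\<sigma> P)] (mod p)))"

text \<open>After clearing the denominator, f g contributes degree 2 (a + b) with leading
  coefficient a product of two units modulo \<open>p\<close>. The term h contributes degree at most
  (a + b - c) + 2 c = a + b + c, which c < a + b keeps strictly below, so nothing can cancel the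
  leading term.\<close>

lemma laurent_move:
  assumes "prime p" and f: "laurent p T \<sigma> a f" and g: "laurent p T \<sigma> b g" and h: "laurent p T \<sigma> c h"
    and c: "c < a + b"
  shows "laurent p T \<sigma> (a + b) (\<lambda>P. (f P * g P - h P) mod p)"
proof -
  obtain F where F: "degree F \<le> 2 * a" "\<not> p dvd coeff F (2 * a)"
      "\<And>P. P \<in> T \<Longrightarrow> [\<sigma> P ^ a * f P = poly F (\<sigma> P)] (mod p)" using f by (auto simp: laurent_def)
  obtain G where G: "degree G \<le> 2 * b" "\<not> p dvd coeff G (2 * b)"
      "\<And>P. P \<in> T \<Longrightarrow> [\<sigma> P ^ b * g P = poly G (\<sigma> P)] (mod p)" using g by (auto simp: laurent_def)
  obtain H where H: "degree H \<le> 2 * c"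
      "\<And>P. P \<in> T \<Longrightarrow> [\<sigma> P ^ c * h P = poly H (\<sigma> P)] (mod p)" using h by (auto simp: laurent_def)
  let ?K = "F * G - monom 1 (a + b - c) * H"
  have dFG: "degree (F * G) \<le> 2 * (a + b)"
    using order_trans[OF degree_mult_le add_mono[OF F(1) G(1)]] by (simp add: distrib_left)
  have "degree (monom (1::int) (a + b - c) * H) \<le> (a + b - c) + 2 * c"
    using degree_mult_le[of "monom (1::int) (a + b - c)" H] degree_monom_le[of "1::int" "a + b - c"] H(1)
    by linarith
  then have dH: "degree (monom (1::int) (a + b - c) * H) < 2 * (a + b)"
    by (rule le_less_trans) (use c in presburger)
  have "degree ?K \<le> 2 * (a + b)" using dFG dH by (intro degree_diff_le) auto
  moreover have "coeff ?K (2 * (a + b)) = coeff F (2 * a) * coeff G (2 * b)"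
  proof -
    \<comment> \<open>A coefficient not divisible by \<open>p\<close> is in particular nonzero, so
      the degree bounds are equalities over the integers.\<close>
    have "degree F = 2 * a" "degree G = 2 * b" using F G by (metis dvd_0_right le_degree le_antisym)+
    then show ?thesis using coeff_mult_degree_sum[of F G] coeff_eq_0[OF dH] by (simp add: distrib_left)
  qed
  moreover have "[\<sigma> P ^ (a + b) * ((f P * g P - h P) mod p) = poly ?K (\<sigma> P)] (mod p)" if "P \<in> T" for P
  proof -
    have "[\<sigma> P ^ (a + b) * ((f P * g P - h P) mod p) = \<sigma> P ^ (a + b) * (f P * g P - h P)] (mod p)"
      by (simp add: cong_def mod_mult_right_eq)
    also have "\<sigma> P ^ (a + b) = \<sigma> P ^ (a + b - c) * \<sigma> P ^ c" using c by (simp flip: power_add)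
    with power_add[of "\<sigma> P" a b] have "\<sigma> P ^ (a + b) * (f P * g P - h P)
      = (\<sigma> P ^ a * f P) * (\<sigma> P ^ b * g P) - \<sigma> P ^ (a + b - c) * (\<sigma> P ^ c * h P)"
      by (simp add: algebra_simps)
    also have "[\<dots> = poly F (\<sigma> P) * poly G (\<sigma> P) - \<sigma> P ^ (a + b - c) * poly H (\<sigma> P)] (mod p)"
      using F(3) G(3) H(2) that by (intro cong_diff cong_mult cong_refl) auto
    finally show ?thesis by (simp add: poly_monom)
  qed
  ultimately show ?thesis unfolding laurent_def using F(2) G(2) \<open>prime p\<close>
    by (intro exI[of _ ?K]) (auto simp: prime_dvd_mult_iff)
qed

text \<open>Multiplying f = g by the \<open>w\<close>-th power of the parameter gives the polynomial
  relation F = X^(w-2) G at every parameter value. The right side has degree at most w + 1 < 2 w, so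
  the top coefficient of F survives in the difference and the root bound applies.\<close>

lemma card_laurent_eq_low:
  fixes p :: int
  assumes "prime p" and f: "laurent p T \<sigma> w f" and g: "laurent_low p T \<sigma> g" and w: "w \<ge> 2"
    and eq: "\<And>P. P \<in> T \<Longrightarrow> f P = g P" and inj: "inj_on \<sigma> T" and \<sigma>: "\<sigma> ` T \<subseteq> {0..<p}"
  shows "card T \<le> 2 * w"
proof -
  obtain F where F: "degree F \<le> 2 * w" "\<not> p dvd coeff F (2 * w)"
      "\<And>P. P \<in> T \<Longrightarrow> [\<sigma> P ^ w * f P = poly F (\<sigma> P)] (mod p)" using f by (auto simp: laurent_def)
  obtain G where G: "degree G \<le> 3"
      "\<And>P. P \<in> T \<Longrightarrow> [\<sigma> P ^ 2 * g P = poly G (\<sigma> P)] (mod p)" using g by (auto simp: laurent_low_def)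
  let ?K = "F - monom 1 (w - 2) * G"
  have "degree (monom (1::int) (w - 2) * G) \<le> (w - 2) + 3"
    using degree_mult_le[of "monom (1::int) (w - 2)" G] degree_monom_le[of "1::int" "w - 2"] G(1)
    by linarith
  then have dG: "degree (monom (1::int) (w - 2) * G) < 2 * w" using w by linarith
  have "degree ?K \<le> 2 * w" using F dG by (intro degree_diff_le) auto
  moreover have "\<not> p dvd coeff ?K (2 * w)" using F(2) coeff_eq_0[OF dG] by simp
  ultimately have "card {s \<in> {0..<p}. p dvd poly ?K s} \<le> 2 * w"
    using card_poly_roots_mod_prime[OF \<open>prime p\<close>] by blast
  moreover have "p dvd poly ?K (\<sigma> P)" if "P \<in> T" for P
  proof -
    have "\<sigma> P ^ w = \<sigma> P ^ (w - 2) * \<sigma> P ^ 2" using w by (metis le_add_diff_inverse2 power_add)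
    then have "\<sigma> P ^ w * f P = \<sigma> P ^ (w - 2) * (\<sigma> P ^ 2 * g P)" using eq[OF that] by simp
    also have "[\<dots> = \<sigma> P ^ (w - 2) * poly G (\<sigma> P)] (mod p)"
      using G(2)[OF that] by (intro cong_mult cong_refl) auto
    finally have "[poly F (\<sigma> P) = \<sigma> P ^ (w - 2) * poly G (\<sigma> P)] (mod p)"
      using F(3)[OF that] by (meson cong_sym cong_trans)
    then show ?thesis by (simp add: cong_iff_dvd_diff poly_monom)
  qed
  then have "\<sigma> ` T \<subseteq> {s \<in> {0..<p}. p dvd poly ?K s}" using \<sigma> by auto
  then have "card (\<sigma> ` T) \<le> card {s \<in> {0..<p}. p dvd poly ?K s}"
    by (rule card_mono[rotated]) (auto intro: rev_finite_subset[of "{0..<p}"])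
  ultimately show ?thesis using card_image[OF inj] by simp
qed

section \<open>Rational parametrization of a slice\<close>

text \<open>Here t = u v - z is the coordinate produced by the first move, \<sigma> is t / u modulo
  \<open>p\<close>, \<open>m\<close> is the inverse of \<open>l\<close>, and k = 1 + l^2. The
  equation becomes \<sigma> u = m (\<sigma>^2 + k), and v = l u, t = \<sigma> u, z = u v - t express
  the remaining coordinates through \<sigma>.\<close>

lemma slice_parametrization:
  fixes p :: int
  assumes "prime p"
    and range: "\<And>P. P \<in> T \<Longrightarrow> u P \<in> {0..<p} \<and> v P \<in> {0..<p} \<and> z P \<in> {0..<p}"
    and inj: "inj_on (\<lambda>P. (u P, v P, z P)) T"
    and eqn: "\<And>P. P \<in> T \<Longrightarrow> p dvd (u P)\<^sup>2 + (v P)\<^sup>2 + (z P)\<^sup>2 - u P * v P * z P"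
    and u: "\<And>P. P \<in> T \<Longrightarrow> \<not> p dvd u P"
    and z: "\<And>P. P \<in> T \<Longrightarrow> \<not> p dvd u P * v P - z P"
    and l: "\<not> p dvd l" "\<And>P. P \<in> T \<Longrightarrow> [v P = l * u P] (mod p)"
  obtains \<sigma> where "inj_on \<sigma> T" "\<sigma> ` T \<subseteq> {0..<p}"
    "laurent p T \<sigma> 1 u" "laurent p T \<sigma> 1 v" "laurent p T \<sigma> 2 (\<lambda>P. (u P * v P - z P) mod p)"
    "laurent_low p T \<sigma> u" "laurent_low p T \<sigma> v" "laurent_low p T \<sigma> z"
proof -
  have p1: "p > 1" using \<open>prime p\<close> by (simp add: prime_gt_1_int)
  have inv: "\<exists>m. [m * a = 1] (mod p)" if "\<not> p dvd a" for a
    using that \<open>prime p\<close> by (metis cong_solve_coprime_int coprime_commute mult.commute prime_imp_coprime)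
  obtain m where m: "[m * l = 1] (mod p)" using inv l(1) by blast
  define k where "k = 1 + l\<^sup>2"
  have "\<exists>s. s \<in> {0..<p} \<and> [u P * v P - z P = s * u P] (mod p)" if P: "P \<in> T" for P
  proof -
    obtain n where n: "[n * u P = 1] (mod p)" using inv u[OF P] by blast
    define s where "s = ((u P * v P - z P) * n) mod p"
    have "[s * u P = (u P * v P - z P) * n * u P] (mod p)"
      unfolding s_def by (simp add: cong_def mod_mult_left_eq)
    also have "[(u P * v P - z P) * n * u P = (u P * v P - z P) * 1] (mod p)"
      using n by (metis cong_scalar_left mult.assoc)
    finally have "[u P * v P - z P = s * u P] (mod p)" by (simp add: cong_sym)
    then show ?thesis using p1 by (intro exI[of _ s]) (auto simp: s_def)
  qed
  then obtain \<sigma> where \<sigma>: "\<And>P. P \<in> T \<Longrightarrow> \<sigma> P \<in> {0..<p}"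
      "\<And>P. P \<in> T \<Longrightarrow> [u P * v P - z P = \<sigma> P * u P] (mod p)" by metis
  have \<sigma>_unit: "\<not> p dvd \<sigma> P" if "P \<in> T" for P
    using z[OF that] \<sigma>(2)[OF that] by (metis cong_dvd_iff dvd_mult2)
  have su: "[\<sigma> P * u P = m * ((\<sigma> P)\<^sup>2 + k)] (mod p)" if P: "P \<in> T" for P
  proof -
    obtain e where e: "(u P)\<^sup>2 + (v P)\<^sup>2 + (z P)\<^sup>2 - u P * v P * z P = p * e"
      using eqn[OF P] by (auto simp: dvd_def)
    obtain f where f: "v P = l * u P + p * f" using l(2)[OF P] by (metis cong_iff_lin cong_sym)
    obtain g where g: "u P * v P - z P = \<sigma> P * u P + p * g" using \<sigma>(2)[OF P] by (metis cong_iff_lin cong_sym)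
    \<comment> \<open>The right side is the Markoff polynomial at (u, l u, \<sigma> u). The factor
      u^2 can be cancelled modulo \<open>p\<close>, leaving an equation linear in u.\<close>
    have "u P * (u P * (k + (\<sigma> P)\<^sup>2 - l * \<sigma> P * u P)) = (u P)\<^sup>2 + (l * u P)\<^sup>2 + (\<sigma> P * u P)\<^sup>2 - u P * (l * u P) * (\<sigma> P * u P)"
      by (simp add: k_def algebra_simps power2_eq_square)
    also have "[\<dots> = (u P)\<^sup>2 + (v P)\<^sup>2 + (u P * v P - z P)\<^sup>2 - u P * v P * (u P * v P - z P)] (mod p)"
      by (intro cong_add cong_diff cong_mult cong_pow cong_refl cong_sym[OF \<sigma>(2)] cong_sym[OF l(2)] P)
    \<comment> \<open>Vieta: z and u v - z are the two roots of the same monic quadratic, so the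
      move preserves the value of the Markoff polynomial.\<close>
    also have "(u P)\<^sup>2 + (v P)\<^sup>2 + (u P * v P - z P)\<^sup>2 - u P * v P * (u P * v P - z P) = p * e"
      using e by (simp add: algebra_simps power2_eq_square)
    also have "[p * e = 0] (mod p)" by (simp add: cong_def)
    finally have "p dvd u P * (u P * (k + (\<sigma> P)\<^sup>2 - l * \<sigma> P * u P))" by (simp add: cong_0_iff)
    then have "p dvd k + (\<sigma> P)\<^sup>2 - l * \<sigma> P * u P"
      using u[OF P] \<open>prime p\<close> by (simp add: prime_dvd_mult_iff)
    then have "[(\<sigma> P)\<^sup>2 + k = l * \<sigma> P * u P] (mod p)" by (simp add: cong_iff_dvd_diff add.commute)
    then have "[m * ((\<sigma> P)\<^sup>2 + k) = m * (l * \<sigma> P * u P)] (mod p)" by (intro cong_mult cong_refl)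
    also have "m * (l * \<sigma> P * u P) = (m * l) * (\<sigma> P * u P)" by simp
    also have "[\<dots> = 1 * (\<sigma> P * u P)] (mod p)" using m by (intro cong_mult cong_refl)
    finally show ?thesis by (simp add: cong_sym)
  qed
  have sv: "[\<sigma> P * v P = (\<sigma> P)\<^sup>2 + k] (mod p)" if P: "P \<in> T" for P
  proof -
    have "[\<sigma> P * v P = \<sigma> P * (l * u P)] (mod p)" using l(2)[OF P] by (intro cong_mult cong_refl)
    also have "\<sigma> P * (l * u P) = l * (\<sigma> P * u P)" by simp
    also have "[\<dots> = l * (m * ((\<sigma> P)\<^sup>2 + k))] (mod p)" using su[OF P] by (rule cong_scalar_left)
    also have "l * (m * ((\<sigma> P)\<^sup>2 + k)) = (m * l) * ((\<sigma> P)\<^sup>2 + k)" by simp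
    also have "[\<dots> = 1 * ((\<sigma> P)\<^sup>2 + k)] (mod p)" using m by (intro cong_mult cong_refl)
    finally show ?thesis by simp
  qed
  have sw: "[(\<sigma> P)\<^sup>2 * (u P * v P - z P) = (\<sigma> P)\<^sup>2 * (m * ((\<sigma> P)\<^sup>2 + k))] (mod p)" if P: "P \<in> T" for P
    using cong_trans[OF \<sigma>(2)[OF P] su[OF P]] by (rule cong_scalar_left)
  have sz: "[(\<sigma> P)\<^sup>2 * z P = m * k * ((\<sigma> P)\<^sup>2 + k)] (mod p)" if P: "P \<in> T" for P
  proof -
    have "(\<sigma> P)\<^sup>2 * z P = (\<sigma> P * u P) * (\<sigma> P * v P) - (\<sigma> P)\<^sup>2 * (u P * v P - z P)"
      by (simp add: algebra_simps power2_eq_square)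
    also have "[\<dots> = m * ((\<sigma> P)\<^sup>2 + k) * ((\<sigma> P)\<^sup>2 + k) - (\<sigma> P)\<^sup>2 * (m * ((\<sigma> P)\<^sup>2 + k))] (mod p)"
      by (intro cong_diff cong_mult su sv sw P)
    finally show ?thesis by (simp add: algebra_simps power2_eq_square)
  qed
  \<comment> \<open>\<open>m\<close> is the leading coefficient of the polynomials for u and for the
    moved coordinate.\<close>
  have m_unit: "\<not> p dvd m"
  proof
    assume "p dvd m"
    then have "p dvd 1" using m by (meson cong_dvd_iff dvd_mult2)
    then show False using p1 by simp
  qed
  have eqI: "a = b" if "[a = b] (mod p)" "a \<in> {0..<p}" "b \<in> {0..<p}" for a b
    using that by (simp add: cong_def)
  \<comment> \<open>The parameter, a unit since t is one, determines u by \<open>su\<close>, then v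
    by the slice equation, then z from u v - z = \<sigma> u.\<close>
  have "inj_on \<sigma> T"
  proof (rule inj_onI)
    fix P Q assume P: "P \<in> T" and Q: "Q \<in> T" and eq: "\<sigma> P = \<sigma> Q"
    have "[\<sigma> P * u P = \<sigma> P * u Q] (mod p)" using su[OF P] su[OF Q] eq by (metis cong_sym cong_trans)
    moreover have "coprime (\<sigma> P) p" using \<sigma>_unit[OF P] \<open>prime p\<close> by (metis coprime_commute prime_imp_coprime)
    ultimately have "[u P = u Q] (mod p)" by (simp add: cong_mult_lcancel)
    then have uu: "u P = u Q" using range P Q by (intro eqI) auto
    have "[v P = v Q] (mod p)" using l(2)[OF P] l(2)[OF Q] uu by (metis cong_sym cong_trans)
    then have vv: "v P = v Q" using range P Q by (intro eqI) auto
    have "[u P * v P - z P = u P * v P - z Q] (mod p)"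
      using \<sigma>(2)[OF P] \<sigma>(2)[OF Q] uu vv eq by (metis cong_sym cong_trans)
    then have "[z P = z Q] (mod p)" by (simp add: cong_iff_dvd_diff dvd_diff_commute)
    then have "z P = z Q" using range P Q by (intro eqI) auto
    with uu vv show "P = Q" using inj P Q by (auto dest: inj_onD)
  qed
  moreover have "\<sigma> ` T \<subseteq> {0..<p}" using \<sigma>(1) by auto
  moreover have "laurent p T \<sigma> 1 u" unfolding laurent_def
    using su m_unit by (intro exI[of _ "[:m * k, 0, m:]"])
      (auto simp: algebra_simps power2_eq_square numeral_2_eq_2)
  moreover have "laurent p T \<sigma> 1 v" unfolding laurent_def
    using sv p1 by (intro exI[of _ "[:k, 0, 1:]"]) (auto simp: algebra_simps power2_eq_square numeral_2_eq_2)
  moreover have "laurent p T \<sigma> 2 (\<lambda>P. (u P * v P - z P) mod p)" unfolding laurent_def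
  proof (intro exI[of _ "[:0, 0, m * k, 0, m:]"] conjI ballI)
    fix P assume P: "P \<in> T"
    have "[(\<sigma> P)\<^sup>2 * ((u P * v P - z P) mod p) = (\<sigma> P)\<^sup>2 * (u P * v P - z P)] (mod p)"
      by (simp add: cong_def mod_mult_right_eq)
    also note sw[OF P]
    finally show "[(\<sigma> P)\<^sup>2 * ((u P * v P - z P) mod p) = poly [:0, 0, m * k, 0, m:] (\<sigma> P)] (mod p)"
      by (simp add: algebra_simps power2_eq_square)
  qed (use m_unit in \<open>auto simp: coeff_pCons eval_nat_numeral\<close>)
  \<comment> \<open>The denominator \<sigma>^2 costs one extra factor \<sigma> compared with
    \<open>su\<close>, which raises the degree from 2 to 3.\<close>
  moreover have "laurent_low p T \<sigma> u" unfolding laurent_low_def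
  proof (intro exI[of _ "[:0, m * k, 0, m:]"] conjI ballI)
    fix P assume P: "P \<in> T"
    have "[\<sigma> P * (\<sigma> P * u P) = \<sigma> P * (m * ((\<sigma> P)\<^sup>2 + k))] (mod p)"
      using su[OF P] by (rule cong_scalar_left)
    then show "[(\<sigma> P)\<^sup>2 * u P = poly [:0, m * k, 0, m:] (\<sigma> P)] (mod p)"
      by (simp add: algebra_simps power2_eq_square)
  qed auto
  moreover have "laurent_low p T \<sigma> v" unfolding laurent_low_def
  proof (intro exI[of _ "[:0, k, 0, 1:]"] conjI ballI)
    fix P assume P: "P \<in> T"
    have "[\<sigma> P * (\<sigma> P * v P) = \<sigma> P * ((\<sigma> P)\<^sup>2 + k)] (mod p)"
      using sv[OF P] by (rule cong_scalar_left)
    then show "[(\<sigma> P)\<^sup>2 * v P = poly [:0, k, 0, 1:] (\<sigma> P)] (mod p)"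
      by (simp add: algebra_simps power2_eq_square)
  qed auto
  moreover have "laurent_low p T \<sigma> z" unfolding laurent_low_def
    using sz by (intro exI[of _ "[:m * k * k, 0, m * k:]"]) (auto simp: algebra_simps power2_eq_square)
  ultimately show thesis by (rule that)
qed

section \<open>Covering the surface by slices\<close>

text \<open>Where u, v or u v - z vanishes modulo \<open>p\<close>, the equation reduces to a sum of
  two squares of two coordinates that determine the point; this accounts for three times 2 p. Every
  other point lies on a slice v = l u with l nonzero. The coordinates are kept abstract so that any
  of the three can play the role of z.\<close>

lemma card_union_slices:
  fixes p :: int
  assumes "prime p" and fin: "finite X"
    and range: "\<And>P. P \<in> X \<Longrightarrow> u P \<in> {0..<p} \<and> v P \<in> {0..<p} \<and> z P \<in> {0..<p}"
    and inj: "inj_on (\<lambda>P. (u P, v P, z P)) X"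
    and eqn: "\<And>P. P \<in> X \<Longrightarrow> p dvd (u P)\<^sup>2 + (v P)\<^sup>2 + (z P)\<^sup>2 - u P * v P * z P"
    and slice: "\<And>T \<sigma>. \<lbrakk>T \<subseteq> X; inj_on \<sigma> T; \<sigma> ` T \<subseteq> {0..<p};
        laurent p T \<sigma> 1 u; laurent p T \<sigma> 1 v; laurent p T \<sigma> 2 (\<lambda>P. (u P * v P - z P) mod p);
        laurent_low p T \<sigma> u; laurent_low p T \<sigma> v; laurent_low p T \<sigma> z\<rbrakk> \<Longrightarrow> card T \<le> K"
  shows "card X \<le> 6 * nat p + nat p * K"
proof -
  let ?I = "{0..<p}"
  have p1: "p > 1" using \<open>prime p\<close> by (simp add: prime_gt_1_int)
  have dvd_range: "p dvd a \<longleftrightarrow> a = 0" if "a \<in> ?I" for a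
    using that by (metis atLeastLessThan_iff dvd_0_right mod_0_imp_dvd mod_eq_0_iff_dvd mod_pos_pos_trivial)
  let ?Q = "{(a, b). a \<in> ?I \<and> b \<in> ?I \<and> p dvd a\<^sup>2 + b\<^sup>2}"
  have finQ: "finite ?Q" by (rule finite_subset[of _ "?I \<times> ?I"]) auto
  have few: "card Y \<le> 2 * nat p" if "inj_on h Y" "h ` Y \<subseteq> ?Q" for Y and h :: "'a \<Rightarrow> int \<times> int"
    using card_inj_on_le[OF that finQ] card_sum_two_squares_mod_prime[OF \<open>prime p\<close>] by linarith
  define U where "U = {P \<in> X. u P = 0}"
  define V where "V = {P \<in> X. v P = 0}"
  define W where "W = {P \<in> X. p dvd u P * v P - z P}"
  define T where "T l = {P \<in> X. u P \<noteq> 0 \<and> v P \<noteq> 0 \<and> \<not> p dvd u P * v P - z P \<and> [v P = l * u P] (mod p)}" for l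
  have injD: "P = Q" if "P \<in> X" "Q \<in> X" "u P = u Q" "v P = v Q" "z P = z Q" for P Q
    using inj that by (auto dest: inj_onD)
  have "card U \<le> 2 * nat p"
  proof (rule few)
    show "inj_on (\<lambda>P. (v P, z P)) U" by (rule inj_onI) (auto simp: U_def intro: injD)
    show "(\<lambda>P. (v P, z P)) ` U \<subseteq> ?Q" using eqn range by (fastforce simp: U_def)
  qed
  moreover have "card V \<le> 2 * nat p"
  proof (rule few)
    show "inj_on (\<lambda>P. (u P, z P)) V" by (rule inj_onI) (auto simp: V_def intro: injD)
    show "(\<lambda>P. (u P, z P)) ` V \<subseteq> ?Q" using eqn range by (fastforce simp: V_def)
  qed
  moreover have "card W \<le> 2 * nat p"
  proof (rule few)
    show "inj_on (\<lambda>P. (u P, v P)) W"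
    proof (rule inj_onI)
      fix P Q assume W: "P \<in> W" "Q \<in> W" and eq: "(u P, v P) = (u Q, v Q)"
      then have "p dvd u P * v P - z P" "p dvd u P * v P - z Q" by (auto simp: W_def)
      then have "p dvd (u P * v P - z P) - (u P * v P - z Q)" by (rule dvd_diff)
      then have "[z P = z Q] (mod p)" by (simp add: cong_iff_dvd_diff dvd_diff_commute)
      then have "z P = z Q" using W range by (auto simp: cong_def W_def)
      then show "P = Q" using W eq by (auto simp: W_def intro: injD)
    qed
    have "p dvd (u P)\<^sup>2 + (v P)\<^sup>2" if "P \<in> W" for P
    proof -
      \<comment> \<open>The Markoff polynomial is u^2 + v^2 - z (u v - z), so on \<open>W\<close>
        only the two squares remain.\<close>
      have "(u P)\<^sup>2 + (v P)\<^sup>2 = ((u P)\<^sup>2 + (v P)\<^sup>2 + (z P)\<^sup>2 - u P * v P * z P) + z P * (u P * v P - z P)"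
        by (simp add: algebra_simps power2_eq_square)
      moreover have "p dvd \<dots>" using that eqn by (intro dvd_add dvd_mult) (auto simp: W_def)
      ultimately show ?thesis by (simp only:)
    qed
    then show "(\<lambda>P. (u P, v P)) ` W \<subseteq> ?Q" using range by (auto simp: W_def)
  qed
  moreover have "card (\<Union>l\<in>{1..<p}. T l) \<le> nat p * K"
  proof -
    have "card (T l) \<le> K" if l: "l \<in> {1..<p}" for l
    proof -
      have TX: "T l \<subseteq> X" by (auto simp: T_def)
      have "\<not> p dvd l" using l dvd_range[of l] by auto
      then obtain \<sigma> where "inj_on \<sigma> (T l)" "\<sigma> ` T l \<subseteq> ?I"
        "laurent p (T l) \<sigma> 1 u" "laurent p (T l) \<sigma> 1 v" "laurent p (T l) \<sigma> 2 (\<lambda>P. (u P * v P - z P) mod p)"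
        "laurent_low p (T l) \<sigma> u" "laurent_low p (T l) \<sigma> v" "laurent_low p (T l) \<sigma> z"
        using slice_parametrization[OF \<open>prime p\<close>, of "T l" u v z l] range eqn dvd_range inj_on_subset[OF inj TX]
        unfolding T_def by blast
      then show ?thesis using slice TX by blast
    qed
    then have "(\<Sum>l\<in>{1..<p}. card (T l)) \<le> (\<Sum>l\<in>{1..<p}. K)" by (intro sum_mono)
    also have "\<dots> = nat (p - 1) * K" by simp
    also have "\<dots> \<le> nat p * K" by (intro mult_right_mono nat_mono) auto
    finally show ?thesis using card_UN_le[of "{1..<p}" T] by simp
  qed
  moreover have "X \<subseteq> (U \<union> V) \<union> W \<union> (\<Union>l\<in>{1..<p}. T l)"
  proof
    fix P assume P: "P \<in> X"
    show "P \<in> (U \<union> V) \<union> W \<union> (\<Union>l\<in>{1..<p}. T l)"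
    proof (cases "P \<in> U \<union> V \<union> W")
      case False
      then have nz: "u P \<noteq> 0" "v P \<noteq> 0" "\<not> p dvd u P * v P - z P" using P by (auto simp: U_def V_def W_def)
      have "coprime (u P) p"
        using nz(1) range[OF P] dvd_range \<open>prime p\<close> by (metis coprime_commute prime_imp_coprime)
      \<comment> \<open>With \<open>n\<close> the inverse of u, the point lies on the slice l = v /
        u, which is nonzero because v is.\<close>
      then obtain n where n: "[u P * n = 1] (mod p)" by (metis cong_solve_coprime_int)
      define l where "l = (v P * n) mod p"
      have "[l * u P = v P * n * u P] (mod p)" unfolding l_def by (simp add: cong_def mod_mult_left_eq)
      also have "v P * n * u P = v P * (u P * n)" by simp
      also have "[\<dots> = v P * 1] (mod p)" using n by (rule cong_scalar_left)
      finally have l: "[v P = l * u P] (mod p)" by (simp add: cong_sym)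
      have "l \<noteq> 0" using l nz(2) range[OF P] dvd_range[of "v P"] by (auto simp: cong_0_iff)
      then have "l \<in> {1..<p}" using p1 pos_mod_sign[of p "v P * n"] pos_mod_bound[of p "v P * n"]
        unfolding l_def atLeastLessThan_iff by linarith
      then show ?thesis using P nz l by (auto simp: T_def)
    qed auto
  qed
  then have "card X \<le> card ((U \<union> V) \<union> W \<union> (\<Union>l\<in>{1..<p}. T l))"
    by (rule card_mono[rotated]) (use fin in \<open>auto simp: U_def V_def W_def T_def\<close>)
  moreover have "\<dots> \<le> card U + card V + card W + card (\<Union>l\<in>{1..<p}. T l)"
    by (intro order_trans[OF card_Un_le] add_mono order_refl)
  ultimately show ?thesis by linarith
qed

section \<open>Matrices of words and growth of degrees\<close>

fun mat2_app :: "mat2 \<Rightarrow> int \<times> int \<Rightarrow> int \<times> int" where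
  "mat2_app (a, b, c, d) (x, y) = (a * x + b * y, c * x + d * y)"

lemma mat2_app_mult: "mat2_app (mat2_mult A B) v = mat2_app A (mat2_app B v)"
  by (cases A; cases B; cases v) (simp add: algebra_simps)

text \<open>The generator matrices are invertible, so they never send a nonzero matrix to zero. This
  yields N >= 1 in the final estimate.\<close>

lemma word_mat_nonzero: "word_mat w \<noteq> (0, 0, 0, 0)"
proof (induction w)
  case Nil
  then show ?case by (simp add: word_mat_def)
next
  case (Cons i w)
  have "word_mat (i # w) = mat2_mult (gen_mat i) (word_mat w)" by (simp add: word_mat_def)
  then show ?case using Cons by (cases "word_mat w") (auto simp: gen_mat_def)
qed

text \<open>The vector on which the \<^term>\<open>j\<close>-th of the forms $|y|$, $|x|$, $|x-y|$ vanishes and the other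
  two equal 1.\<close>

definition start_vec :: "nat \<Rightarrow> int \<times> int" where
  "start_vec j = (if j = 1 then (1, 0) else if j = 2 then (0, 1) else (1, 1))"

text \<open>\<open>foldr\<close> applies the last letter first, so \<open>last w\<close> is the
  first move and selects the start vector. From the values 0, 1, 1 that move produces 2, 1, 1,
  exactly the degrees found in \<open>slice_parametrization\<close>.\<close>

definition word_vec :: "nat list \<Rightarrow> int \<times> int" where
  "word_vec w = mat2_app (word_mat w) (start_vec (last w))"

lemma word_vec_Cons: "w \<noteq> [] \<Longrightarrow> word_vec (i # w) = mat2_app (gen_mat i) (word_vec w)"
  by (simp add: word_vec_def word_mat_def mat2_app_mult)

text \<open>The degrees of the three coordinates are the values of $|y|$, $|x|$, $|x-y|$ at
  \<^term>\<open>word_vec w\<close>: applying a letter other than the previous one replaces the corresponding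
  value by the sum of the other two, both for the move and for the matrix.\<close>

definition growth :: "int \<Rightarrow> (int \<times> int \<times> int) set \<Rightarrow> (int \<times> int \<times> int \<Rightarrow> int) \<Rightarrow> nat list \<Rightarrow> bool" where
  "growth p T \<sigma> w \<longleftrightarrow> (\<exists>a b c.
     laurent p T \<sigma> a (\<lambda>P. fst (word_act p w P)) \<and>
     laurent p T \<sigma> b (\<lambda>P. fst (snd (word_act p w P))) \<and>
     laurent p T \<sigma> c (\<lambda>P. snd (snd (word_act p w P))) \<and>
     a > 0 \<and> b > 0 \<and> c > 0 \<and>
     (if hd w = 1 then a = b + c else if hd w = 2 then b = a + c else c = a + b) \<and>
     int a = \<bar>snd (word_vec w)\<bar> \<and> int b = \<bar>fst (word_vec w)\<bar> \<and> int c = \<bar>fst (word_vec w) - snd (word_vec w)\<bar>)"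

lemma move_coords:
  "markoff_move p i P = (if i = 1 then ((fst (snd P) * snd (snd P) - fst P) mod p, fst (snd P), snd (snd P))
     else if i = 2 then (fst P, (fst P * snd (snd P) - fst (snd P)) mod p, snd (snd P))
     else (fst P, fst (snd P), (fst P * fst (snd P) - snd (snd P)) mod p))"
  by (cases P) simp

lemma reduced_word_Cons:
  assumes "reduced_word (i # w)"
  shows "i \<in> {1, 2, 3}" "reduced_word w" "w \<noteq> [] \<Longrightarrow> i \<noteq> hd w"
proof -
  show "i \<in> {1, 2, 3}" using assms by (simp add: reduced_word_def)
  have adj: "\<And>k. Suc k < length (i # w) \<Longrightarrow> (i # w) ! k \<noteq> (i # w) ! Suc k"
    using assms unfolding reduced_word_def by blast
  show "reduced_word w" using assms adj[of "Suc _"] by (auto simp: reduced_word_def)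
  show "i \<noteq> hd w" if "w \<noteq> []" using adj[of 0] that by (simp add: hd_conv_nth)
qed

text \<open>Induction on later moves, added at the front. The coordinate just moved has degree equal
  to the sum of the other two; the next letter differs from it, so it replaces a coordinate of
  degree smaller than the sum of the other two, as \<open>laurent_move\<close> requires.\<close>

lemma growth_word:
  assumes "prime p" and "growth p T \<sigma> [last w]" and "reduced_word w" and "w \<noteq> []"
  shows "growth p T \<sigma> w"
  using assms(2-)
proof (induction w)
  case Nil
  then show ?case by simp
next
  case (Cons i w)
  show ?case
  proof (cases "w = []")
    case True
    then show ?thesis using Cons.prems(1) by simp
  next
    case False
    note red = reduced_word_Cons[OF Cons.prems(2)]
    have "growth p T \<sigma> w" using Cons.IH Cons.prems(1) red False by simp
    then obtain a b c where
      L: "laurent p T \<sigma> a (\<lambda>P. fst (word_act p w P))"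
         "laurent p T \<sigma> b (\<lambda>P. fst (snd (word_act p w P)))"
         "laurent p T \<sigma> c (\<lambda>P. snd (snd (word_act p w P)))"
      and pos: "a > 0" "b > 0" "c > 0"
      and sum: "if hd w = 1 then a = b + c else if hd w = 2 then b = a + c else c = a + b"
      and vec: "int a = \<bar>snd (word_vec w)\<bar>" "int b = \<bar>fst (word_vec w)\<bar>"
               "int c = \<bar>fst (word_vec w) - snd (word_vec w)\<bar>"
      unfolding growth_def by blast
    have act: "word_act p (i # w) P = markoff_move p i (word_act p w P)" for P
      by (simp add: word_act_def)
    obtain x y where xy: "word_vec w = (x, y)" by fastforce
    have hd: "hd w \<in> {1, 2, 3}" "hd w \<noteq> i"
      using red False by (auto simp: reduced_word_def dest!: hd_in_set)
    consider "i = 1" | "i = 2" | "i = 3" using red(1) by auto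
    then show ?thesis
    proof cases
      case 1
      then have "b = a + c \<or> c = a + b" using hd sum by auto
      \<comment> \<open>The numbers |x + (x - y)| and |x - (x - y)| are b + c and |b - c| in some
        order. The second is |y| = a = |b - c| < b + c, so the first, |2 x - y|, is b + c. The other
        two cases are analogous.\<close>
      then have "a < b + c" "int (b + c) = \<bar>2 * x - y\<bar>" using vec pos xy by auto
      with laurent_move[OF \<open>prime p\<close> L(2,3,1)] show ?thesis
        unfolding growth_def word_vec_Cons[OF False] act move_coords using 1 L pos vec
        by (intro exI[of _ "b + c"] exI[of _ b] exI[of _ c]) (auto simp: xy gen_mat_def)
    next
      case 2
      then have "a = b + c \<or> c = a + b" using hd sum by auto
      then have "b < a + c" "int (a + c) = \<bar>2 * y - x\<bar>" using vec pos xy by auto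
      with laurent_move[OF \<open>prime p\<close> L(1,3,2)] show ?thesis
        unfolding growth_def word_vec_Cons[OF False] act move_coords using 2 L pos vec
        by (intro exI[of _ a] exI[of _ "a + c"] exI[of _ c]) (auto simp: xy gen_mat_def)
    next
      case 3
      then have "a = b + c \<or> b = a + c" using hd sum by auto
      then have "c < a + b" "int (a + b) = \<bar>x + y\<bar>" using vec pos xy by auto
      with laurent_move[OF \<open>prime p\<close> L(1,2,3)] show ?thesis
        unfolding growth_def word_vec_Cons[OF False] act move_coords using 3 L pos vec
        by (intro exI[of _ a] exI[of _ b] exI[of _ "a + b"]) (auto simp: xy gen_mat_def)
    qed
  qed
qed

section \<open>Counting fixed points\<close>

text \<open>At a fixed point every coordinate of the image equals the original one, which is of low
  degree on the slice. It is enough to compare them in one coordinate whose degree has grown to at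
  least 2.\<close>

lemma card_slice_le:
  assumes "prime p" and red: "reduced_word w" "w \<noteq> []"
    and base: "growth p T \<sigma> [last w]"
    and inj: "inj_on \<sigma> T" "\<sigma> ` T \<subseteq> {0..<p}"
    and low: "laurent_low p T \<sigma> fst" "laurent_low p T \<sigma> (\<lambda>P. fst (snd P))" "laurent_low p T \<sigma> (\<lambda>P. snd (snd P))"
    and fixp: "\<And>P. P \<in> T \<Longrightarrow> word_act p w P = P"
    and N: "\<bar>fst (word_vec w)\<bar> \<le> 2 * N" "\<bar>snd (word_vec w)\<bar> \<le> 2 * N"
  shows "card T \<le> 8 * nat N"
proof -
  obtain a b c where
      L: "laurent p T \<sigma> a (\<lambda>P. fst (word_act p w P))"
         "laurent p T \<sigma> b (\<lambda>P. fst (snd (word_act p w P)))"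
         "laurent p T \<sigma> c (\<lambda>P. snd (snd (word_act p w P)))"
      and pos: "a > 0" "b > 0" "c > 0"
      and sum: "if hd w = 1 then a = b + c else if hd w = 2 then b = a + c else c = a + b"
      and vec: "int a = \<bar>snd (word_vec w)\<bar>" "int b = \<bar>fst (word_vec w)\<bar>"
               "int c = \<bar>fst (word_vec w) - snd (word_vec w)\<bar>"
    using growth_word[OF \<open>prime p\<close> base red] unfolding growth_def by blast
  \<comment> \<open>The third degree is |x - y|, hence at most 4 N; the root count is twice a
    degree, which gives 8 N.\<close>
  have bound: "a \<le> 4 * nat N" "b \<le> 4 * nat N" "c \<le> 4 * nat N" using vec N by linarith+
  \<comment> \<open>One degree is the sum of the other two, and these are positive.\<close>
  consider "a \<ge> 2" | "b \<ge> 2" | "c \<ge> 2" using sum pos by (auto split: if_splits)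
  then show ?thesis
  proof cases
    case 1
    from card_laurent_eq_low[OF \<open>prime p\<close> L(1) low(1) this _ inj] show ?thesis using fixp bound by fastforce
  next
    case 2
    from card_laurent_eq_low[OF \<open>prime p\<close> L(2) low(2) this _ inj] show ?thesis using fixp bound by fastforce
  next
    case 3
    from card_laurent_eq_low[OF \<open>prime p\<close> L(3) low(3) this _ inj] show ?thesis using fixp bound by fastforce
  qed
qed

lemma card_fixed_points_le:
  fixes p N :: int
  assumes "prime p" and red: "reduced_word w" "w \<noteq> []"
    and N: "\<bar>fst (word_vec w)\<bar> \<le> 2 * N" "\<bar>snd (word_vec w)\<bar> \<le> 2 * N"
  shows "card {P \<in> markoff_pts p. word_act p w P = P} \<le> 6 * nat p + nat p * (8 * nat N)"
    (is "card ?X \<le> _")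
proof -
  let ?x = "fst :: int \<times> int \<times> int \<Rightarrow> int"
  let ?y = "\<lambda>P :: int \<times> int \<times> int. fst (snd P)" and ?z = "\<lambda>P :: int \<times> int \<times> int. snd (snd P)"
  have fin: "finite ?X"
    by (rule finite_subset[of _ "{0..<p} \<times> {0..<p} \<times> {0..<p}"]) (auto simp: markoff_pts_def)
  have range: "?x P \<in> {0..<p} \<and> ?y P \<in> {0..<p} \<and> ?z P \<in> {0..<p}"
    and eqn: "p dvd (?x P)\<^sup>2 + (?y P)\<^sup>2 + (?z P)\<^sup>2 - ?x P * ?y P * ?z P" if "P \<in> ?X" for P
    using that by (auto simp: markoff_pts_def)
  \<comment> \<open>Base cases for the three possible first moves: degree 2 for the moved coordinate
    and 1 for the others.\<close>
  have growth1: "growth p T \<sigma> [Suc 0]"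
    if "laurent p T \<sigma> 1 ?y" "laurent p T \<sigma> 1 ?z" "laurent p T \<sigma> 2 (\<lambda>P. (?y P * ?z P - ?x P) mod p)" for T \<sigma>
    unfolding growth_def using that
    by (intro exI[of _ 2] exI[of _ 1] exI[of _ 1])
      (simp add: word_act_def word_vec_def word_mat_def start_vec_def gen_mat_def move_coords)
  have growth2: "growth p T \<sigma> [2]"
    if "laurent p T \<sigma> 1 ?x" "laurent p T \<sigma> 1 ?z" "laurent p T \<sigma> 2 (\<lambda>P. (?x P * ?z P - ?y P) mod p)" for T \<sigma>
    unfolding growth_def using that
    by (intro exI[of _ 1] exI[of _ 2] exI[of _ 1])
      (simp add: word_act_def word_vec_def word_mat_def start_vec_def gen_mat_def move_coords)
  have growth3: "growth p T \<sigma> [3]"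
    if "laurent p T \<sigma> 1 ?x" "laurent p T \<sigma> 1 ?y" "laurent p T \<sigma> 2 (\<lambda>P. (?x P * ?y P - ?z P) mod p)" for T \<sigma>
    unfolding growth_def using that
    by (intro exI[of _ 1] exI[of _ 1] exI[of _ 2])
      (simp add: word_act_def word_vec_def word_mat_def start_vec_def gen_mat_def move_coords)
  have "last w \<in> {1, 2, 3}" using red last_in_set[of w] unfolding reduced_word_def by blast
  then consider "last w = 1" | "last w = 2" | "last w = 3" by auto
  then show ?thesis
  proof cases
    case 1
    show ?thesis
    proof (rule card_union_slices[OF \<open>prime p\<close> fin, of ?y ?z ?x])
      show "p dvd (?y P)\<^sup>2 + (?z P)\<^sup>2 + (?x P)\<^sup>2 - ?y P * ?z P * ?x P" if "P \<in> ?X" for P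
        using eqn[OF that] by (simp add: ac_simps)
    next
      fix T and \<sigma> :: "int \<times> int \<times> int \<Rightarrow> int" assume "T \<subseteq> ?X" "inj_on \<sigma> T" "\<sigma> ` T \<subseteq> {0..<p}"
        "laurent p T \<sigma> 1 ?y" "laurent p T \<sigma> 1 ?z" "laurent p T \<sigma> 2 (\<lambda>P. (?y P * ?z P - ?x P) mod p)"
        "laurent_low p T \<sigma> ?y" "laurent_low p T \<sigma> ?z" "laurent_low p T \<sigma> ?x"
      then show "card T \<le> 8 * nat N"
        using 1 growth1 by (intro card_slice_le[OF \<open>prime p\<close> red, of T \<sigma>] N) auto
    qed (use range in \<open>auto simp: inj_on_def\<close>)
  next
    case 2
    show ?thesis
    proof (rule card_union_slices[OF \<open>prime p\<close> fin, of ?x ?z ?y])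
      show "p dvd (?x P)\<^sup>2 + (?z P)\<^sup>2 + (?y P)\<^sup>2 - ?x P * ?z P * ?y P" if "P \<in> ?X" for P
        using eqn[OF that] by (simp add: ac_simps)
    next
      fix T and \<sigma> :: "int \<times> int \<times> int \<Rightarrow> int" assume "T \<subseteq> ?X" "inj_on \<sigma> T" "\<sigma> ` T \<subseteq> {0..<p}"
        "laurent p T \<sigma> 1 ?x" "laurent p T \<sigma> 1 ?z" "laurent p T \<sigma> 2 (\<lambda>P. (?x P * ?z P - ?y P) mod p)"
        "laurent_low p T \<sigma> ?x" "laurent_low p T \<sigma> ?z" "laurent_low p T \<sigma> ?y"
      then show "card T \<le> 8 * nat N"
        using 2 growth2 by (intro card_slice_le[OF \<open>prime p\<close> red, of T \<sigma>] N) auto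
    qed (use range in \<open>auto simp: inj_on_def\<close>)
  next
    case 3
    show ?thesis
    proof (rule card_union_slices[OF \<open>prime p\<close> fin, of ?x ?y ?z])
      fix T and \<sigma> :: "int \<times> int \<times> int \<Rightarrow> int" assume "T \<subseteq> ?X" "inj_on \<sigma> T" "\<sigma> ` T \<subseteq> {0..<p}"
        "laurent p T \<sigma> 1 ?x" "laurent p T \<sigma> 1 ?y" "laurent p T \<sigma> 2 (\<lambda>P. (?x P * ?y P - ?z P) mod p)"
        "laurent_low p T \<sigma> ?x" "laurent_low p T \<sigma> ?y" "laurent_low p T \<sigma> ?z"
      then show "card T \<le> 8 * nat N"
        using 3 growth3 by (intro card_slice_le[OF \<open>prime p\<close> red, of T \<sigma>] N) auto
    qed (use range eqn in \<open>auto simp: inj_on_def\<close>)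
  qed
qed

theorem theorem6p1:
  fixes p :: int and w :: "nat list" and a b c d N :: int
  assumes "prime p" and "odd p"
    and "reduced_word w" and "w \<noteq> []"
    and "represented_by w (a,b,c,d)"
    and "N = max (max \<bar>a\<bar> \<bar>b\<bar>) (max \<bar>c\<bar> \<bar>d\<bar>)"
    and "real_of_int N \<le> (real_of_int p / 128) powr (1/8)"
  shows "real (card {P \<in> markoff_pts p. word_act p w P = P}) \<le> 1024 * real_of_int p * real_of_int N ^ 8"
proof -
  let ?F = "card {P \<in> markoff_pts p. word_act p w P = P}"
  obtain e f g h where M: "word_mat w = (e, f, g, h)" by (metis surj_pair)
  have eN: "\<bar>e\<bar> \<le> N" "\<bar>f\<bar> \<le> N" "\<bar>g\<bar> \<le> N" "\<bar>h\<bar> \<le> N"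
  proof -
    have "\<bar>e\<bar> = \<bar>a\<bar>" "\<bar>f\<bar> = \<bar>b\<bar>" "\<bar>g\<bar> = \<bar>c\<bar>" "\<bar>h\<bar> = \<bar>d\<bar>"
      using assms(5) M by (auto simp: represented_by_def)
    then show "\<bar>e\<bar> \<le> N" "\<bar>f\<bar> \<le> N" "\<bar>g\<bar> \<le> N" "\<bar>h\<bar> \<le> N"
      unfolding assms(6) by (simp_all add: le_max_iff_disj)
  qed
  \<comment> \<open>The start vectors pick out a column of the matrix or the sum of both columns, so
    the entries of \<open>word_vec w\<close> are at most 2 N in absolute value.\<close>
  have vec: "word_vec w \<in> {(e, g), (f, h), (e + f, g + h)}" by (simp add: word_vec_def M start_vec_def)
  have le: "?F \<le> 6 * nat p + nat p * (8 * nat N)"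
    by (rule card_fixed_points_le) (use assms(1,3,4) vec eN in auto)
  have "N \<noteq> 0" using eN M word_mat_nonzero[of w] by auto
  then have N: "N \<ge> 1" using eN(1) by linarith
  have p: "real (nat p) = p" using prime_gt_1_int[OF \<open>prime p\<close>] by simp
  have "real ?F \<le> real (6 * nat p + nat p * (8 * nat N))" using le by (rule of_nat_mono)
  also have "\<dots> = real_of_int p * (6 + 8 * real_of_int N)" using N p by (simp add: distrib_left)
  also have "\<dots> \<le> p * (1024 * real_of_int N ^ 8)"
  proof (rule mult_left_mono)
    \<comment> \<open>For N >= 1 the left side is at most 14 N, and N <= N^8.\<close>
    have N': "1 \<le> real_of_int N" using N by simp
    then have "real_of_int N \<le> real_of_int N ^ 8" by (intro self_le_power) auto
    with N' show "6 + 8 * real_of_int N \<le> 1024 * real_of_int N ^ 8" by linarith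
  qed (use p in linarith)
  finally show ?thesis by simp
qed

end
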